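(* Let $k\in\mathbb Z$, let $\phi=k^3-k_1^3-k_2^3-k_3^3$ and $|k_m|=\max\{|k|,|k_1|,|k_2|,|k_3|\}$, and let $$\Gamma(k)=\{(k_1,k_2,k_3)\in\mathbb Z^3:\ k_1+k_2+k_3=k,\ k_1+k_2\ne0,\ k_1+k_3\ne0,\ k_2+k_3\neq0\},$$ $$\Gamma_1(k)=\{(k_1,k_2,k_3)\in\Gamma(k):|\phi|<\tfrac14|k_m|^2\},\qquad \Gamma_2(k)=\{(k_1,k_2,k_3)\in\Gamma(k):|\phi|\ge\tfrac14|k_m|^2\}.$$ Then the following hold, with all constants independent of $k,k_1,k_2,k_3$. (1) There is a constant $C>0$ such that $|k_m|\le C|\phi|$ for all $(k_1,k_2,k_3)\in\Gamma(k)$. (2) There is a constant $C>0$ such that for all $(k_1,k_2,k_3)\in\Gamma_1(k)$ one has $|k|\sim|k_1|\sim|k_2|\sim|k_3|$, i.e. each of $|k|,|k_1|,|k_2|,|k_3|$ is at most $C$ times any other. (3) For every $\varepsilon>0$ there is a constant $c>0$ such that, with $$\Gamma_{21}(k)=\{(k_1,k_2,k_3)\in\Gamma_2(k):\tfrac14|k_m|^2\le|\phi|<c|k_m|^{15/7}\},\qquad \Gamma_{22}(k)=\{(k_1,k_2,k_3)\in\Gamma_2(k):|\phi|\ge c|k_m|^{15/7}\},$$ we have $\Gamma_2(k)=\Gamma_{21}(k)\cup\Gamma_{22}(k)$, and for every $(k_1,k_2,k_3)\in\Gamma_{21}(k)$ there exist $j,h\in\{1,2,3\}$, $j\neq h$,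 with $|k_j+k_h|\le\varepsilon|k_m|^{5/7}$. *)

theory Defs
  imports Complex_Main
begin

type_synonym triple = "int \<times> int \<times> int"

definition phi :: "int \<Rightarrow> triple \<Rightarrow> int" where
  "phi k = (\<lambda>(k1, k2, k3). k^3 - k1^3 - k2^3 - k3^3)"

(* The quantity |k_m|; only the absolute value of k_m is ever used, so k_m itself is not named. *)
definition abs_km :: "int \<Rightarrow> triple \<Rightarrow> int" where
  "abs_km k = (\<lambda>(k1, k2, k3). Max {\<bar>k\<bar>, \<bar>k1\<bar>, \<bar>k2\<bar>, \<bar>k3\<bar>})"

definition Gamma :: "int \<Rightarrow> triple set" where
  "Gamma k = {(k1, k2, k3). k1 + k2 + k3 = k \<and> k1 + k2 \<noteq> 0 \<and> k1 + k3 \<noteq> 0 \<and> k2 + k3 \<noteq> 0}"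

definition Gamma1 :: "int \<Rightarrow> triple set" where
  "Gamma1 k = {t \<in> Gamma k. real_of_int \<bar>phi k t\<bar> < 1/4 * (real_of_int (abs_km k t))^2}"

definition Gamma2 :: "int \<Rightarrow> triple set" where
  "Gamma2 k = {t \<in> Gamma k. real_of_int \<bar>phi k t\<bar> \<ge> 1/4 * (real_of_int (abs_km k t))^2}"

definition Gamma21 :: "real \<Rightarrow> int \<Rightarrow> triple set" where
  "Gamma21 c k = {t \<in> Gamma2 k.
     1/4 * (real_of_int (abs_km k t))^2 \<le> real_of_int \<bar>phi k t\<bar> \<and>
     real_of_int \<bar>phi k t\<bar> < c * real_of_int (abs_km k t) powr (15/7)}"

definition Gamma22 :: "real \<Rightarrow> int \<Rightarrow> triple set" where
  "Gamma22 c k = {t \<in> Gamma2 k.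
     real_of_int \<bar>phi k t\<bar> \<ge> c * real_of_int (abs_km k t) powr (15/7)}"

(* entry (k1, k2, k3) j is k_j for j in {1, 2, 3}; other indices are never used. *)
definition entry :: "triple \<Rightarrow> nat \<Rightarrow> int" where
  "entry = (\<lambda>(k1, k2, k3) j. if j = 1 then k1 else if j = 2 then k2 else k3)"

end

theory Submission
  imports Defs
begin

text \<open>
  Everything rests on the factorisation \<open>\<phi> = 3 (k1 + k2) (k1 + k3) (k2 + k3)\<close>, valid when
  \<open>k = k1 + k2 + k3\<close> (lemma \<open>phi_factor\<close>). The numbers \<open>2k\<close>, \<open>2k1\<close>, \<open>2k2\<close>, \<open>2k3\<close> are the
  combinations of the three pair sums with at most one minus sign, so twice the largest frequency
  \<open>M\<close> is at most the sum of the absolute values of the pair sums (lemma \<open>abs_km_le_pair_sums\<close>),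
  and the largest pair sum is at least \<open>2M/3\<close>.

  (1) On \<open>\<Gamma>(k)\<close> the pair sums are nonzero integers, so none of them exceeds their product
  in absolute value, which bounds \<open>M\<close> by \<open>|\<phi>|\<close>.

  (2) If \<open>|\<phi>| < M\<^sup>2/4\<close>, dividing by the largest pair sum leaves less than \<open>M/8\<close> for the product
  of the other two, hence for each of them. The largest pair sum then dominates in all four
  combinations, and every frequency is at least \<open>5M/24\<close> (lemmas \<open>dominant_factor\<close> and
  \<open>Gamma1_comparable\<close>).

  (3) If all pair sums exceeded \<open>\<epsilon> M\<^bsup>5/7\<^esup>\<close>, then bounding one factor of \<open>\<phi>\<close> by \<open>2M/3\<close> and the other
  two by \<open>\<epsilon> M\<^bsup>5/7\<^esup>\<close> would give \<open>|\<phi>| \<ge> 2 \<epsilon>\<^sup>2 M\<^bsup>17/7\<^esup>\<close>, which is at least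
  \<open>2 \<epsilon>\<^sup>2 M\<^bsup>15/7\<^esup>\<close> because \<open>M \<ge> 1\<close>. So \<open>c = 2 \<epsilon>\<^sup>2\<close> works (lemma \<open>Gamma21_small_pair_sum\<close>).
\<close>

lemma phi_factor:
  assumes "k1 + k2 + k3 = k"
  shows "phi k (k1, k2, k3) = 3 * ((k1 + k2) * (k1 + k3) * (k2 + k3))"
  unfolding phi_def assms[symmetric] by (simp add: algebra_simps power3_eq_cube)

lemma abs_km_ge: "x \<in> {\<bar>k\<bar>, \<bar>k1\<bar>, \<bar>k2\<bar>, \<bar>k3\<bar>} \<Longrightarrow> x \<le> abs_km k (k1, k2, k3)"
  unfolding abs_km_def by (simp del: Max_insert)

lemma abs_km_mem: "abs_km k (k1, k2, k3) \<in> {\<bar>k\<bar>, \<bar>k1\<bar>, \<bar>k2\<bar>, \<bar>k3\<bar>}"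
proof -
  have "Max {\<bar>k\<bar>, \<bar>k1\<bar>, \<bar>k2\<bar>, \<bar>k3\<bar>} \<in> {\<bar>k\<bar>, \<bar>k1\<bar>, \<bar>k2\<bar>, \<bar>k3\<bar>}"
    by (rule Max_in) auto
  then show ?thesis
    unfolding abs_km_def by simp
qed

text \<open>Twice each frequency is a signed sum of the three pair sums, e.g.
  \<open>2 k1 = (k1 + k2) + (k1 + k3) - (k2 + k3)\<close>.\<close>

lemma abs_km_le_pair_sums:
  assumes "k1 + k2 + k3 = k"
  shows "2 * abs_km k (k1, k2, k3) \<le> \<bar>k1 + k2\<bar> + \<bar>k1 + k3\<bar> + \<bar>k2 + k3\<bar>"
  using abs_km_mem[of k k1 k2 k3] assms by (simp, arith)

lemma abs_km_pos:
  assumes "(k1, k2, k3) \<in> Gamma k"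
  shows "1 \<le> abs_km k (k1, k2, k3)"
proof -
  have "k1 \<noteq> 0 \<or> k2 \<noteq> 0"
    using assms unfolding Gamma_def by auto
  then show ?thesis
    using abs_km_ge[of "\<bar>k1\<bar>" k k1 k2 k3] abs_km_ge[of "\<bar>k2\<bar>" k k1 k2 k3] by auto
qed

lemma abs_km_le_abs_phi:
  assumes "(k1, k2, k3) \<in> Gamma k"
  shows "abs_km k (k1, k2, k3) \<le> \<bar>phi k (k1, k2, k3)\<bar>"
proof -
  define x y z where "x = \<bar>k1 + k2\<bar>" and "y = \<bar>k1 + k3\<bar>" and "z = \<bar>k2 + k3\<bar>"
  have sum: "k1 + k2 + k3 = k" and pos: "1 \<le> x" "1 \<le> y" "1 \<le> z"
    using assms unfolding Gamma_def x_def y_def z_def by auto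
  have phi: "\<bar>phi k (k1, k2, k3)\<bar> = 3 * (x * y * z)"
    unfolding phi_factor[OF sum] x_def y_def z_def by (simp add: abs_mult)
  have "x * 1 \<le> x * (y * z)" "y * 1 \<le> y * (x * z)" "z * 1 \<le> z * (x * y)"
    using pos mult_mono[of 1 y 1 z] mult_mono[of 1 x 1 z] mult_mono[of 1 x 1 y]
    by (intro mult_left_mono; simp)+
  then have "x + y + z \<le> 3 * (x * y * z)"
    by (simp add: mult_ac)
  then show ?thesis
    using abs_km_le_pair_sums[OF sum] abs_km_pos[OF assms] unfolding phi x_def y_def z_def
    by linarith
qed

text \<open>Meant for \<open>x\<close> the largest pair sum in absolute value, and \<open>y\<close>, \<open>z\<close> the other two. Cancelling \<open>x\<close>
  against one power of \<open>M\<close> gives \<open>8 y z < M\<close>, and \<open>y\<close> and \<open>z\<close> are each bounded by their product.\<close>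

lemma dominant_factor:
  fixes x y z M :: int
  assumes "1 \<le> y" "1 \<le> z" "0 < M" "2 * M \<le> 3 * x" and small: "12 * (x * y * z) < M\<^sup>2"
  shows "5 * M \<le> 12 * (x - y - z)"
proof -
  have "(2 * M) * (y * z) \<le> (3 * x) * (y * z)"
    using assms by (intro mult_right_mono) auto
  then have "M * (8 * (y * z)) < M * M"
    using small by (simp add: power2_eq_square mult_ac)
  then have yz: "8 * (y * z) < M"
    using \<open>0 < M\<close> by simp
  have "y \<le> y * z" "z \<le> y * z"
    using mult_left_mono[of 1 z y] mult_right_mono[of 1 y z] assms by auto
  then show ?thesis
    using yz \<open>2 * M \<le> 3 * x\<close> unfolding right_diff_distrib by linarith
qed

lemma Gamma1_comparable:
  assumes "(k1, k2, k3) \<in> Gamma1 k" and n: "n \<in> {\<bar>k\<bar>, \<bar>k1\<bar>, \<bar>k2\<bar>, \<bar>k3\<bar>}"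
  shows "5 * abs_km k (k1, k2, k3) \<le> 24 * n"
proof -
  define M where "M = abs_km k (k1, k2, k3)"
  define x y z where "x = \<bar>k1 + k2\<bar>" and "y = \<bar>k1 + k3\<bar>" and "z = \<bar>k2 + k3\<bar>"
  have G: "(k1, k2, k3) \<in> Gamma k"
    and small: "real_of_int \<bar>phi k (k1, k2, k3)\<bar> < 1/4 * (real_of_int M)\<^sup>2"
    using assms(1) unfolding Gamma1_def M_def by auto
  have sum: "k1 + k2 + k3 = k" and pos: "1 \<le> x" "1 \<le> y" "1 \<le> z"
    using G unfolding Gamma_def x_def y_def z_def by auto
  have "0 < M"
    using abs_km_pos[OF G] unfolding M_def by simp
  have "\<bar>phi k (k1, k2, k3)\<bar> = 3 * (x * y * z)"
    unfolding phi_factor[OF sum] x_def y_def z_def by (simp add: abs_mult)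
  then have "real_of_int (12 * (x * y * z)) < real_of_int (M\<^sup>2)"
    using small by simp
  then have prod: "12 * (x * y * z) < M\<^sup>2"
    by linarith
  have "2 * M \<le> x + y + z"
    using abs_km_le_pair_sums[OF sum] unfolding M_def x_def y_def z_def .
  then consider "2 * M \<le> 3 * x" | "2 * M \<le> 3 * y" | "2 * M \<le> 3 * z"
    by linarith
  then have "5 * M \<le> 12 * (x - y - z) \<or> 5 * M \<le> 12 * (y - x - z) \<or> 5 * M \<le> 12 * (z - x - y)"
  proof cases
    case 1
    then show ?thesis
      using dominant_factor[of y z M x] pos \<open>0 < M\<close> prod by simp
  next
    case 2
    then show ?thesis
      using dominant_factor[of x z M y] pos \<open>0 < M\<close> prod by (simp add: mult_ac)
  next
    case 3
    then show ?thesis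
      using dominant_factor[of x y M z] pos \<open>0 < M\<close> prod by (simp add: mult_ac)
  qed
  \<comment> \<open>\<open>2 n\<close> is the absolute value of a signed sum of the pair sums, so it is at least the
    dominant one minus the other two.\<close>
  moreover have "x - y - z \<le> 2 * n" "y - x - z \<le> 2 * n" "z - x - y \<le> 2 * n"
    using n sum unfolding x_def y_def z_def by (simp, arith)+
  ultimately show ?thesis
    unfolding M_def by (elim disjE) auto
qed

text \<open>One factor has size \<open>M\<close> and two have size \<open>M\<^bsup>5/7\<^esup>\<close>; rounding the exponent \<open>1 + 2 \<cdot> (5/7) = 17/7\<close> down to \<open>15/7\<close> is where \<open>M \<ge> 1\<close> enters.\<close>

lemma product_lower_bound:
  fixes x y z M e :: real
  assumes "1 \<le> M" "0 < e" "2 * M \<le> 3 * x" "e * M powr (5/7) \<le> y" "e * M powr (5/7) \<le> z"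
  shows "2 * e\<^sup>2 * M powr (15/7) \<le> 3 * (x * y * z)"
proof -
  define p where "p = M powr (5/7)"
  have p: "e * p \<le> y" "e * p \<le> z" "0 \<le> e * p"
    using assms unfolding p_def by auto
  have "M powr (15/7) \<le> M powr (1 + 5/7 + 5/7)"
    using assms by (intro powr_mono) auto
  also have "\<dots> = M * (p * p)"
    using assms unfolding p_def by (simp only: powr_add) simp
  finally have "2 * e\<^sup>2 * M powr (15/7) \<le> 2 * e\<^sup>2 * (M * (p * p))"
    by (intro mult_left_mono) auto
  also have "\<dots> = (2 * M) * ((e * p) * (e * p))"
    by (simp add: power2_eq_square mult_ac)
  also have "\<dots> \<le> (3 * x) * (y * z)"
    by (rule mult_mono[OF _ mult_mono]) (use assms p in auto)
  finally show ?thesis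
    by (simp add: mult_ac)
qed

lemma Gamma21_small_pair_sum:
  assumes "0 < e" and t: "(k1, k2, k3) \<in> Gamma21 (2 * e\<^sup>2) k"
  shows "real_of_int \<bar>k1 + k2\<bar> \<le> e * real_of_int (abs_km k (k1, k2, k3)) powr (5/7) \<or>
         real_of_int \<bar>k1 + k3\<bar> \<le> e * real_of_int (abs_km k (k1, k2, k3)) powr (5/7) \<or>
         real_of_int \<bar>k2 + k3\<bar> \<le> e * real_of_int (abs_km k (k1, k2, k3)) powr (5/7)"
proof (rule ccontr)
  define M where "M = real_of_int (abs_km k (k1, k2, k3))"
  define x y z where "x = real_of_int \<bar>k1 + k2\<bar>" and "y = real_of_int \<bar>k1 + k3\<bar>"
    and "z = real_of_int \<bar>k2 + k3\<bar>"
  assume "\<not> ?thesis"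
  then have large: "e * M powr (5/7) \<le> x" "e * M powr (5/7) \<le> y" "e * M powr (5/7) \<le> z"
    unfolding M_def x_def y_def z_def by auto
  have G: "(k1, k2, k3) \<in> Gamma k"
    and small: "real_of_int \<bar>phi k (k1, k2, k3)\<bar> < 2 * e\<^sup>2 * M powr (15/7)"
    using t unfolding Gamma21_def Gamma2_def M_def by auto
  have sum: "k1 + k2 + k3 = k"
    using G unfolding Gamma_def by simp
  have "1 \<le> M"
    using abs_km_pos[OF G] unfolding M_def by simp
  have phi: "real_of_int \<bar>phi k (k1, k2, k3)\<bar> = 3 * (x * y * z)"
    unfolding phi_factor[OF sum] x_def y_def z_def by (simp add: abs_mult)
  have "2 * M \<le> x + y + z"
    using abs_km_le_pair_sums[OF sum] unfolding M_def x_def y_def z_def by linarith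
  then consider "2 * M \<le> 3 * x" | "2 * M \<le> 3 * y" | "2 * M \<le> 3 * z"
    by linarith
  then have "2 * e\<^sup>2 * M powr (15/7) \<le> 3 * (x * y * z)"
  proof cases
    case 1
    then show ?thesis
      using product_lower_bound[of M e x y z] \<open>1 \<le> M\<close> \<open>0 < e\<close> large by simp
  next
    case 2
    then show ?thesis
      using product_lower_bound[of M e y x z] \<open>1 \<le> M\<close> \<open>0 < e\<close> large by (simp add: mult_ac)
  next
    case 3
    then show ?thesis
      using product_lower_bound[of M e z x y] \<open>1 \<le> M\<close> \<open>0 < e\<close> large by (simp add: mult_ac)
  qed
  then show False
    using small phi by linarith
qed

lemma Gamma2_split: "Gamma2 k = Gamma21 c k \<union> Gamma22 c k"
  unfolding Gamma21_def Gamma22_def Gamma2_def by auto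

theorem lemma3p3:
  shows
    "(\<exists>C::real. C > 0 \<and>
        (\<forall>k::int. \<forall>t \<in> Gamma k. real_of_int (abs_km k t) \<le> C * real_of_int \<bar>phi k t\<bar>)) \<and>
     (\<exists>C::real. C > 0 \<and>
        (\<forall>k::int. \<forall>(k1, k2, k3) \<in> Gamma1 k.
           \<forall>x \<in> {\<bar>k\<bar>, \<bar>k1\<bar>, \<bar>k2\<bar>, \<bar>k3\<bar>}. \<forall>y \<in> {\<bar>k\<bar>, \<bar>k1\<bar>, \<bar>k2\<bar>, \<bar>k3\<bar>}.
             real_of_int x \<le> C * real_of_int y)) \<and>
     (\<forall>\<epsilon>::real. \<epsilon> > 0 \<longrightarrow>
        (\<exists>c::real. c > 0 \<and>
           (\<forall>k::int. Gamma2 k = Gamma21 c k \<union> Gamma22 c k \<and>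
              (\<forall>t \<in> Gamma21 c k. \<exists>j \<in> {1, 2, 3}. \<exists>h \<in> {1, 2, 3}. j \<noteq> h \<and>
                 real_of_int \<bar>entry t j + entry t h\<bar>
                   \<le> \<epsilon> * real_of_int (abs_km k t) powr (5/7)))))"
proof (intro conjI allI impI)
  show "\<exists>C::real. C > 0 \<and>
      (\<forall>k::int. \<forall>t \<in> Gamma k. real_of_int (abs_km k t) \<le> C * real_of_int \<bar>phi k t\<bar>)"
    using abs_km_le_abs_phi by (intro exI[of _ 1]) force
next
  have "real_of_int x \<le> 5 * real_of_int y"
    if "(k1, k2, k3) \<in> Gamma1 k" "x \<in> {\<bar>k\<bar>, \<bar>k1\<bar>, \<bar>k2\<bar>, \<bar>k3\<bar>}" "y \<in> {\<bar>k\<bar>, \<bar>k1\<bar>, \<bar>k2\<bar>, \<bar>k3\<bar>}"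
    for k k1 k2 k3 x y
  proof -
    have "0 \<le> y"
      using that(3) by auto
    then have "x \<le> 5 * y"
      using Gamma1_comparable[OF that(1,3)] abs_km_ge[OF that(2)] by linarith
    then show ?thesis
      by linarith
  qed
  then show "\<exists>C::real. C > 0 \<and>
      (\<forall>k::int. \<forall>(k1, k2, k3) \<in> Gamma1 k.
         \<forall>x \<in> {\<bar>k\<bar>, \<bar>k1\<bar>, \<bar>k2\<bar>, \<bar>k3\<bar>}. \<forall>y \<in> {\<bar>k\<bar>, \<bar>k1\<bar>, \<bar>k2\<bar>, \<bar>k3\<bar>}.
           real_of_int x \<le> C * real_of_int y)"
    by (intro exI[of _ 5]) (fastforce simp only: split_beta prod.collapse zero_less_numeral)
next
  fix \<epsilon> :: real
  assume "\<epsilon> > 0"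
  have pair: "\<exists>j \<in> {1, 2, 3}. \<exists>h \<in> {1, 2, 3}. j \<noteq> h \<and>
      real_of_int \<bar>entry t j + entry t h\<bar> \<le> \<epsilon> * real_of_int (abs_km k t) powr (5/7)"
    if t: "t \<in> Gamma21 (2 * \<epsilon>\<^sup>2) k" for k t
  proof -
    obtain k1 k2 k3 where eq: "t = (k1, k2, k3)"
      by (cases t) auto
    have "entry t 1 = k1" "entry t 2 = k2" "entry t 3 = k3"
      unfolding eq entry_def by auto
    moreover have "(1::nat) \<noteq> 2" "(1::nat) \<noteq> 3" "(2::nat) \<noteq> 3"
      by auto
    ultimately show ?thesis
      using Gamma21_small_pair_sum[OF \<open>\<epsilon> > 0\<close> t[unfolded eq]] unfolding eq[symmetric]
      by (metis insertCI)
  qed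
  show "\<exists>c::real. c > 0 \<and>
      (\<forall>k::int. Gamma2 k = Gamma21 c k \<union> Gamma22 c k \<and>
        (\<forall>t \<in> Gamma21 c k. \<exists>j \<in> {1, 2, 3}. \<exists>h \<in> {1, 2, 3}. j \<noteq> h \<and>
           real_of_int \<bar>entry t j + entry t h\<bar>
             \<le> \<epsilon> * real_of_int (abs_km k t) powr (5/7)))"
    using pair Gamma2_split \<open>\<epsilon> > 0\<close> by (intro exI[of _ "2 * \<epsilon>\<^sup>2"]) auto
qed

end
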